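(* Let $\mathbf{M}=\langle\mathbf{H},\square,\Diamond\rangle$ be a modal Heyting algebra and $F\subseteq H$ a Boolean filter such that if $a\wedge b=\bot$ and $a\vee b\in F$ then $\square a\vee\Diamond b\in F$. Consider the modal Nelson lattice $\mathbf{N}(\mathbf{M},F)$. Then $\mathbf{M}$ is isomorphic to $\mathbf{M}^*_{\mathbf{N}(\mathbf{M},F)}=\langle\mathbf{H}^*,\square^*,\Diamond^*\rangle$ via $h\colon H\to H^*$, $h(a)=(a,-a)$, and moreover $h[F]=F^*$.
   Context: A modal Heyting algebra is $\langle\mathbf{H},\square,\Diamond\rangle$ with $\mathbf{H}$ a Heyting algebra (implication $\rightharpoonup$, $-a=a\rightharpoonup\bot$) and unary $\square,\Diamond$ satisfying $\square a\wedge\Diamond(-a\wedge b)=\bot$. A Boolean filter is a filter containing all dense elements ($--a=\top$). $\mathbf{N}(\mathbf{M},F)$ is the twist structure on $\{(x,y)\in H\times H: x\wedge y=\bot,\ x\vee y\in F\}$ with $(x,y)\vee(s,t)=(x\vee s,y\wedge t)$, $(x,y)\wedge(s,t)=(x\wedge s,y\vee t)$, $(x,y)*(s,t)=(x\wedge s,(x\rightharpoonup t)\wedge(s\rightharpoonup y))$, $(x,y)\Rightarrow(s,t)=((x\rightharpoonup s)\wedge(t\rightharpoonup y),x\wedge t)$, $\top=(\top,\bot)$, $\bot=(\bot,\top)$, $\sim(x,y)=(y,x)$, and modal operators $\blacksquare(x,y)=(\square x,\Diamond y)$, $\Diamond_N(x,y)=(\Diamond x,\square y)$ (here $\Diamond_N$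 denotes the Nelson-level diamond, written as a black lozenge in the paper); it is a modal Nelson lattice. For a modal Nelson lattice $\mathbf{N}=\langle\mathbf{A},\blacksquare,\Diamond_N\rangle$ (with $a^2=a*a$), $\mathbf{H}^*$ is the Heyting algebra on $H^*=\{a\in A:a^2=a\}$ with $a\vee^*b=(a\vee b)^2$, $a\wedge^*b=(a\wedge b)^2$, $a\rightharpoonup^*b=(a^2\Rightarrow b)^2$; $\square^*a=(\blacksquare a)^2$, $\Diamond^*a=(\Diamond_N a)^2$; and $F^*=\{(a\vee\sim a)^2:a\in A\}$. *)

theory Defs
  imports "HOL-Algebra.Congruence"
begin

record 'a lattice_alg = "'a partial_object" +
  join :: "['a, 'a] \<Rightarrow> 'a" (infixl "\<squnion>\<index>" 65)
  meet :: "['a, 'a] \<Rightarrow> 'a" (infixl "\<sqinter>\<index>" 70)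
  bot  :: 'a ("\<bottom>\<index>")
  top  :: 'a ("\<top>\<index>")

record 'a heyting_alg = "'a lattice_alg" +
  himp :: "['a, 'a] \<Rightarrow> 'a" (infixr "\<rightharpoonup>\<index>" 60)

record 'a modal_heyting_alg = "'a heyting_alg" +
  box :: "'a \<Rightarrow> 'a" ("\<box>\<index> _" [81] 80)
  dia :: "'a \<Rightarrow> 'a" ("\<diamond>\<index> _" [81] 80)

text \<open>Signature of modal Nelson lattices: \<open>\<odot>\<close> is the monoid operation, \<open>\<sim>\<close> the involutive
  negation, \<open>nbox\<close> and \<open>ndia\<close> are the Nelson-level modalities.\<close>

record 'a modal_nelson_alg = "'a lattice_alg" +
  nmult :: "['a, 'a] \<Rightarrow> 'a" (infixl "\<odot>\<index>" 70)
  nimp  :: "['a, 'a] \<Rightarrow> 'a" (infixr "\<leadsto>\<index>" 60)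
  nneg  :: "'a \<Rightarrow> 'a" ("\<sim>\<index> _" [81] 80)
  nbox  :: "'a \<Rightarrow> 'a"
  ndia  :: "'a \<Rightarrow> 'a"

definition hneg :: "('a, 'm) heyting_alg_scheme \<Rightarrow> 'a \<Rightarrow> 'a" where
  "hneg H a = a \<rightharpoonup>\<^bsub>H\<^esub> \<bottom>\<^bsub>H\<^esub>"

definition lat_le :: "('a, 'm) lattice_alg_scheme \<Rightarrow> 'a \<Rightarrow> 'a \<Rightarrow> bool" where
  "lat_le L a b \<longleftrightarrow> a \<sqinter>\<^bsub>L\<^esub> b = a"

locale bounded_lattice_alg =
  fixes L (structure)
  assumes join_closed: "\<lbrakk>a \<in> carrier L; b \<in> carrier L\<rbrakk> \<Longrightarrow> a \<squnion> b \<in> carrier L"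
    and meet_closed: "\<lbrakk>a \<in> carrier L; b \<in> carrier L\<rbrakk> \<Longrightarrow> a \<sqinter> b \<in> carrier L"
    and bot_closed: "\<bottom> \<in> carrier L"
    and top_closed: "\<top> \<in> carrier L"
    and join_comm: "\<lbrakk>a \<in> carrier L; b \<in> carrier L\<rbrakk> \<Longrightarrow> a \<squnion> b = b \<squnion> a"
    and meet_comm: "\<lbrakk>a \<in> carrier L; b \<in> carrier L\<rbrakk> \<Longrightarrow> a \<sqinter> b = b \<sqinter> a"
    and join_assoc: "\<lbrakk>a \<in> carrier L; b \<in> carrier L; c \<in> carrier L\<rbrakk>
          \<Longrightarrow> (a \<squnion> b) \<squnion> c = a \<squnion> (b \<squnion> c)"
    and meet_assoc: "\<lbrakk>a \<in> carrier L; b \<in> carrier L; c \<in> carrier L\<rbrakk>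
          \<Longrightarrow> (a \<sqinter> b) \<sqinter> c = a \<sqinter> (b \<sqinter> c)"
    and join_absorb: "\<lbrakk>a \<in> carrier L; b \<in> carrier L\<rbrakk> \<Longrightarrow> a \<squnion> (a \<sqinter> b) = a"
    and meet_absorb: "\<lbrakk>a \<in> carrier L; b \<in> carrier L\<rbrakk> \<Longrightarrow> a \<sqinter> (a \<squnion> b) = a"
    and bot_least: "a \<in> carrier L \<Longrightarrow> \<bottom> \<sqinter> a = \<bottom>"
    and top_greatest: "a \<in> carrier L \<Longrightarrow> a \<sqinter> \<top> = a"

locale heyting_algebra = bounded_lattice_alg H for H (structure) +
  assumes himp_closed: "\<lbrakk>a \<in> carrier H; b \<in> carrier H\<rbrakk> \<Longrightarrow> a \<rightharpoonup> b \<in> carrier H"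
    and residuation: "\<lbrakk>a \<in> carrier H; b \<in> carrier H; c \<in> carrier H\<rbrakk>
          \<Longrightarrow> lat_le H (a \<sqinter> b) c \<longleftrightarrow> lat_le H a (b \<rightharpoonup> c)"

locale modal_heyting_algebra = heyting_algebra M for M (structure) +
  assumes box_closed: "a \<in> carrier M \<Longrightarrow> \<box> a \<in> carrier M"
    and dia_closed: "a \<in> carrier M \<Longrightarrow> \<diamond> a \<in> carrier M"
    and box_dia: "\<lbrakk>a \<in> carrier M; b \<in> carrier M\<rbrakk>
          \<Longrightarrow> \<box> a \<sqinter> \<diamond> (hneg M a \<sqinter> b) = \<bottom>"

definition lattice_filter :: "('a, 'm) lattice_alg_scheme \<Rightarrow> 'a set \<Rightarrow> bool" where
  "lattice_filter L F \<longleftrightarrow>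
     F \<subseteq> carrier L \<and> F \<noteq> {} \<and>
     (\<forall>a\<in>F. \<forall>b\<in>F. a \<sqinter>\<^bsub>L\<^esub> b \<in> F) \<and>
     (\<forall>a\<in>F. \<forall>b\<in>carrier L. lat_le L a b \<longrightarrow> b \<in> F)"

definition boolean_filter :: "('a, 'm) heyting_alg_scheme \<Rightarrow> 'a set \<Rightarrow> bool" where
  "boolean_filter H F \<longleftrightarrow>
     lattice_filter H F \<and>
     (\<forall>a\<in>carrier H. hneg H (hneg H a) = \<top>\<^bsub>H\<^esub> \<longrightarrow> a \<in> F)"

definition twist :: "('a, 'm) modal_heyting_alg_scheme \<Rightarrow> 'a set \<Rightarrow> ('a \<times> 'a) modal_nelson_alg"
  where
  "twist M F = \<lparr>
     carrier = {(x, y). x \<in> carrier M \<and> y \<in> carrier M \<and> x \<sqinter>\<^bsub>M\<^esub> y = \<bottom>\<^bsub>M\<^esub> \<and> x \<squnion>\<^bsub>M\<^esub> y \<in> F},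
     join = (\<lambda>(x, y) (s, t). (x \<squnion>\<^bsub>M\<^esub> s, y \<sqinter>\<^bsub>M\<^esub> t)),
     meet = (\<lambda>(x, y) (s, t). (x \<sqinter>\<^bsub>M\<^esub> s, y \<squnion>\<^bsub>M\<^esub> t)),
     bot = (\<bottom>\<^bsub>M\<^esub>, \<top>\<^bsub>M\<^esub>),
     top = (\<top>\<^bsub>M\<^esub>, \<bottom>\<^bsub>M\<^esub>),
     nmult = (\<lambda>(x, y) (s, t). (x \<sqinter>\<^bsub>M\<^esub> s, (x \<rightharpoonup>\<^bsub>M\<^esub> t) \<sqinter>\<^bsub>M\<^esub> (s \<rightharpoonup>\<^bsub>M\<^esub> y))),
     nimp = (\<lambda>(x, y) (s, t). ((x \<rightharpoonup>\<^bsub>M\<^esub> s) \<sqinter>\<^bsub>M\<^esub> (t \<rightharpoonup>\<^bsub>M\<^esub> y), x \<sqinter>\<^bsub>M\<^esub> t)),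
     nneg = (\<lambda>(x, y). (y, x)),
     nbox = (\<lambda>(x, y). (\<box>\<^bsub>M\<^esub> x, \<diamond>\<^bsub>M\<^esub> y)),
     ndia = (\<lambda>(x, y). (\<diamond>\<^bsub>M\<^esub> x, \<box>\<^bsub>M\<^esub> y)) \<rparr>"

definition nsq :: "('a, 'm) modal_nelson_alg_scheme \<Rightarrow> 'a \<Rightarrow> 'a" where
  "nsq N a = a \<odot>\<^bsub>N\<^esub> a"

text \<open>The bounds of \<open>H*\<close> are those of \<open>N\<close>, which are idempotent in every Nelson lattice.\<close>

definition star :: "('a, 'm) modal_nelson_alg_scheme \<Rightarrow> 'a modal_heyting_alg" where
  "star N = \<lparr>
     carrier = {a \<in> carrier N. nsq N a = a},
     join = (\<lambda>a b. nsq N (a \<squnion>\<^bsub>N\<^esub> b)),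
     meet = (\<lambda>a b. nsq N (a \<sqinter>\<^bsub>N\<^esub> b)),
     bot = \<bottom>\<^bsub>N\<^esub>,
     top = \<top>\<^bsub>N\<^esub>,
     himp = (\<lambda>a b. nsq N (nsq N a \<leadsto>\<^bsub>N\<^esub> b)),
     box = (\<lambda>a. nsq N (nbox N a)),
     dia = (\<lambda>a. nsq N (ndia N a)) \<rparr>"

definition star_filter :: "('a, 'm) modal_nelson_alg_scheme \<Rightarrow> 'a set" where
  "star_filter N = {nsq N (a \<squnion>\<^bsub>N\<^esub> \<sim>\<^bsub>N\<^esub> a) | a. a \<in> carrier N}"

definition modal_heyting_iso ::
    "('a, 'm) modal_heyting_alg_scheme \<Rightarrow> ('b, 'n) modal_heyting_alg_scheme \<Rightarrow> ('a \<Rightarrow> 'b) set"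
  where
  "modal_heyting_iso M M' = {h.
     bij_betw h (carrier M) (carrier M') \<and>
     (\<forall>a\<in>carrier M. \<forall>b\<in>carrier M.
        h (a \<squnion>\<^bsub>M\<^esub> b) = h a \<squnion>\<^bsub>M'\<^esub> h b \<and>
        h (a \<sqinter>\<^bsub>M\<^esub> b) = h a \<sqinter>\<^bsub>M'\<^esub> h b \<and>
        h (a \<rightharpoonup>\<^bsub>M\<^esub> b) = h a \<rightharpoonup>\<^bsub>M'\<^esub> h b) \<and>
     h \<bottom>\<^bsub>M\<^esub> = \<bottom>\<^bsub>M'\<^esub> \<and>
     h \<top>\<^bsub>M\<^esub> = \<top>\<^bsub>M'\<^esub> \<and>
     (\<forall>a\<in>carrier M. h (\<box>\<^bsub>M\<^esub> a) = \<box>\<^bsub>M'\<^esub> h a \<and> h (\<diamond>\<^bsub>M\<^esub> a) = \<diamond>\<^bsub>M'\<^esub> h a)}"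

lemma modal_heyting_algebra_iso_image:
  assumes M: "modal_heyting_algebra M" and h: "h \<in> modal_heyting_iso M M'"
  shows "modal_heyting_algebra M'"
proof -
  interpret modal_heyting_algebra M by (rule M)
  have inj: "inj_on h (carrier M)" and im: "carrier M' = h ` carrier M"
    using h by (auto simp: modal_heyting_iso_def bij_betw_def)
  have hom: "h a \<squnion>\<^bsub>M'\<^esub> h b = h (a \<squnion>\<^bsub>M\<^esub> b)" "h a \<sqinter>\<^bsub>M'\<^esub> h b = h (a \<sqinter>\<^bsub>M\<^esub> b)"
      "h a \<rightharpoonup>\<^bsub>M'\<^esub> h b = h (a \<rightharpoonup>\<^bsub>M\<^esub> b)" "\<box>\<^bsub>M'\<^esub> h a = h (\<box>\<^bsub>M\<^esub> a)" "\<diamond>\<^bsub>M'\<^esub> h a = h (\<diamond>\<^bsub>M\<^esub> a)"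
      if "a \<in> carrier M" "b \<in> carrier M" for a b
    using h that by (auto simp: modal_heyting_iso_def)
  have bds: "\<bottom>\<^bsub>M'\<^esub> = h \<bottom>\<^bsub>M\<^esub>" "\<top>\<^bsub>M'\<^esub> = h \<top>\<^bsub>M\<^esub>"
    using h by (auto simp: modal_heyting_iso_def)
  note cl = join_closed meet_closed himp_closed box_closed dia_closed bot_closed top_closed
  have le: "lat_le M' (h a) (h b) \<longleftrightarrow> lat_le M a b" if "a \<in> carrier M" "b \<in> carrier M" for a b
    using that inj by (auto simp: lat_le_def hom cl inj_on_eq_iff)
  have neg: "hneg M' (h a) = h (hneg M a)" "hneg M a \<in> carrier M" if "a \<in> carrier M" for a
    using that by (auto simp: hneg_def bds hom cl)
  show ?thesis
    by unfold_locales
      (auto simp: im bds hom cl le neg join_assoc meet_assoc join_absorb meet_absorb bot_least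
        top_greatest box_dia residuation, (metis join_comm meet_comm)+)
qed

end

theory Submission
  imports Defs
begin

text \<open>In a Heyting algebra \<open>x \<sqinter> y = \<bottom>\<close> forces \<open>(x \<rightharpoonup> y) = -x\<close>, so squaring a twist pair gives
  \<open>(x, y)\<^sup>2 = (x, -x)\<close>: it forgets the second coordinate. Every operation of \<open>H*\<close> is the
  square of a pair with disjoint components, so only the first coordinate matters, and there
  the operations are those of \<open>M\<close>. Boolean filters enter because \<open>x \<squnion> -x\<close> is dense.\<close>

context bounded_lattice_alg
begin

text \<open>One absorption law rewrites \<open>a\<close> as
  \<open>a \<squnion> (a \<sqinter> a)\<close>; the other then evaluates
  \<open>a \<sqinter> (a \<squnion> (a \<sqinter> a))\<close>.\<close>

lemma meet_idem: "a \<in> carrier L \<Longrightarrow> a \<sqinter> a = a"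
  by (metis join_absorb meet_absorb meet_closed)

lemma le_refl: "a \<in> carrier L \<Longrightarrow> lat_le L a a"
  by (simp add: lat_le_def meet_idem)

lemma le_antisym:
  "\<lbrakk>lat_le L a b; lat_le L b a; a \<in> carrier L; b \<in> carrier L\<rbrakk> \<Longrightarrow> a = b"
  by (metis lat_le_def meet_comm)

lemma meet_lower1: "\<lbrakk>a \<in> carrier L; b \<in> carrier L\<rbrakk> \<Longrightarrow> lat_le L (a \<sqinter> b) a"
  by (metis lat_le_def meet_assoc meet_comm meet_idem)

lemma meet_lower2: "\<lbrakk>a \<in> carrier L; b \<in> carrier L\<rbrakk> \<Longrightarrow> lat_le L (a \<sqinter> b) b"
  by (metis lat_le_def meet_assoc meet_idem)

lemma meet_greatest:
  "\<lbrakk>lat_le L c a; lat_le L c b; a \<in> carrier L; b \<in> carrier L; c \<in> carrier L\<rbrakk>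
    \<Longrightarrow> lat_le L c (a \<sqinter> b)"
  by (metis lat_le_def meet_assoc)

lemma le_iff_join: "\<lbrakk>a \<in> carrier L; b \<in> carrier L\<rbrakk> \<Longrightarrow> lat_le L a b \<longleftrightarrow> a \<squnion> b = b"
  by (metis lat_le_def meet_absorb join_absorb join_comm meet_comm)

lemma join_upper1: "\<lbrakk>a \<in> carrier L; b \<in> carrier L\<rbrakk> \<Longrightarrow> lat_le L a (a \<squnion> b)"
  by (simp add: lat_le_def meet_absorb)

lemma join_upper2: "\<lbrakk>a \<in> carrier L; b \<in> carrier L\<rbrakk> \<Longrightarrow> lat_le L b (a \<squnion> b)"
  by (metis join_comm join_upper1)

lemma join_least:
  "\<lbrakk>lat_le L a c; lat_le L b c; a \<in> carrier L; b \<in> carrier L; c \<in> carrier L\<rbrakk>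
    \<Longrightarrow> lat_le L (a \<squnion> b) c"
  by (metis le_iff_join join_assoc join_closed)

lemma bot_le: "a \<in> carrier L \<Longrightarrow> lat_le L \<bottom> a"
  by (simp add: lat_le_def bot_least)

lemma le_bot_iff: "a \<in> carrier L \<Longrightarrow> lat_le L a \<bottom> \<longleftrightarrow> a = \<bottom>"
  by (metis bot_closed bot_le le_antisym le_refl)

lemma join_bot: "a \<in> carrier L \<Longrightarrow> a \<squnion> \<bottom> = a"
  by (metis bot_closed bot_le join_comm le_iff_join)

end

context heyting_algebra
begin

lemma hneg_closed: "a \<in> carrier H \<Longrightarrow> hneg H a \<in> carrier H"
  by (simp add: hneg_def himp_closed bot_closed)

text \<open>Residuation at \<open>\<bottom>\<close>. It translates every disjointness claim below
  into an inequality with a pseudocomplement and back.\<close>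

lemma le_hneg_iff:
  "\<lbrakk>a \<in> carrier H; b \<in> carrier H\<rbrakk> \<Longrightarrow> lat_le H a (hneg H b) \<longleftrightarrow> b \<sqinter> a = \<bottom>"
  by (metis hneg_def residuation bot_closed le_bot_iff meet_closed meet_comm)

lemma meet_hneg: "a \<in> carrier H \<Longrightarrow> a \<sqinter> hneg H a = \<bottom>"
  using hneg_closed le_hneg_iff le_refl by blast

lemma hneg_antimono:
  assumes "lat_le H a b" "a \<in> carrier H" "b \<in> carrier H"
  shows "lat_le H (hneg H b) (hneg H a)"
proof -
  have "a \<sqinter> hneg H b = a \<sqinter> (b \<sqinter> hneg H b)"
    using assms by (metis hneg_closed lat_le_def meet_assoc)
  then show ?thesis
    using assms by (metis bot_closed bot_least hneg_closed le_hneg_iff meet_comm meet_hneg)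
qed

lemma le_hneg_hneg: "a \<in> carrier H \<Longrightarrow> lat_le H a (hneg H (hneg H a))"
  by (metis hneg_closed le_hneg_iff meet_comm meet_hneg)

text \<open>By modus ponens \<open>(x \<rightharpoonup> y) \<sqinter> x\<close> lies below both
  \<open>x\<close> and \<open>y\<close>, hence below \<open>\<bottom>\<close>; conversely
  \<open>hneg H x \<sqinter> x = \<bottom>\<close> lies below \<open>y\<close>.\<close>

lemma himp_eq_hneg:
  assumes "x \<in> carrier H" "y \<in> carrier H" "x \<sqinter> y = \<bottom>"
  shows "x \<rightharpoonup> y = hneg H x"
proof (rule le_antisym)
  let ?i = "x \<rightharpoonup> y"
  have i: "?i \<in> carrier H" using assms by (simp add: himp_closed)
  then have "lat_le H (?i \<sqinter> x) y" using assms by (simp add: residuation le_refl)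
  then have "lat_le H (?i \<sqinter> x) (x \<sqinter> y)"
    using assms(1,2) i by (simp add: meet_closed meet_greatest meet_lower2)
  then show "lat_le H ?i (hneg H x)"
    using assms i by (simp add: bot_closed hneg_def flip: residuation)
  show "lat_le H (hneg H x) ?i"
    using assms by (metis bot_le hneg_closed meet_comm meet_hneg residuation)
qed (use assms in \<open>simp_all add: himp_closed hneg_closed\<close>)

lemma hneg_bot: "hneg H \<bottom> = \<top>"
proof (rule le_antisym)
  show "lat_le H (hneg H \<bottom>) \<top>"
    by (simp add: lat_le_def top_greatest hneg_closed bot_closed)
qed (simp_all add: le_hneg_iff bot_closed top_closed bot_least hneg_closed)

lemma hneg_top: "hneg H \<top> = \<bottom>"
  by (metis hneg_closed meet_comm meet_hneg top_closed top_greatest)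

text \<open>The pseudocomplement of the join lies below both \<open>hneg H a\<close> and
  \<open>hneg H (hneg H a)\<close>, which are disjoint, so it is \<open>\<bottom>\<close>.\<close>

lemma join_hneg_dense:
  assumes "a \<in> carrier H"
  shows "hneg H (hneg H (a \<squnion> hneg H a)) = \<top>"
proof -
  let ?z = "hneg H (a \<squnion> hneg H a)"
  have cl: "hneg H a \<in> carrier H" "?z \<in> carrier H"
    using assms by (simp_all add: hneg_closed join_closed)
  have "lat_le H ?z (hneg H a)" "lat_le H ?z (hneg H (hneg H a))"
    using assms cl by (simp_all add: hneg_antimono join_closed join_upper1 join_upper2)
  then have "?z = \<bottom>"
    using assms cl by (metis lat_le_def le_hneg_iff meet_comm)
  then show ?thesis by (simp add: hneg_bot)
qed

text \<open>Puts each pair \<open>(a, hneg H a)\<close> into the carrier of the twist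
  structure.\<close>

lemma join_hneg_mem:
  assumes "boolean_filter H F" "a \<in> carrier H"
  shows "a \<squnion> hneg H a \<in> F"
  using assms join_hneg_dense[of a]
  by (auto simp: boolean_filter_def join_closed hneg_closed)

text \<open>The Nelson join of \<open>(a, hneg H a)\<close> and \<open>(b, hneg H b)\<close> has
  these two coordinates, so it can be squared. Both \<open>a\<close> and \<open>b\<close> lie below
  the pseudocomplement of the second coordinate, hence so does their join.\<close>

lemma join_disjoint_hneg_meet:
  assumes "a \<in> carrier H" "b \<in> carrier H"
  shows "(a \<squnion> b) \<sqinter> (hneg H a \<sqinter> hneg H b) = \<bottom>"
proof -
  have "lat_le H (hneg H a \<sqinter> hneg H b) (hneg H a)" "lat_le H (hneg H a \<sqinter> hneg H b) (hneg H b)"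
    using assms by (simp_all add: hneg_closed meet_lower1 meet_lower2)
  then have "lat_le H a (hneg H (hneg H a \<sqinter> hneg H b))" "lat_le H b (hneg H (hneg H a \<sqinter> hneg H b))"
    using assms by (metis hneg_closed le_hneg_iff meet_closed meet_comm)+
  then have "lat_le H (a \<squnion> b) (hneg H (hneg H a \<sqinter> hneg H b))"
    using assms by (simp add: join_least hneg_closed meet_closed)
  then show ?thesis
    using assms by (metis hneg_closed le_hneg_iff meet_closed join_closed meet_comm)
qed

text \<open>The same disjointness for the Nelson meet: both pseudocomplements lie below that of
  \<open>a \<sqinter> b\<close>.\<close>

lemma meet_disjoint_hneg_join:
  assumes "a \<in> carrier H" "b \<in> carrier H"
  shows "(a \<sqinter> b) \<sqinter> (hneg H a \<squnion> hneg H b) = \<bottom>"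
proof -
  have "lat_le H (hneg H a \<squnion> hneg H b) (hneg H (a \<sqinter> b))"
    using assms
    by (simp add: hneg_antimono hneg_closed join_least meet_closed meet_lower1 meet_lower2)
  then show ?thesis
    using assms by (simp add: le_hneg_iff hneg_closed join_closed meet_closed)
qed

text \<open>Disjointness for the Nelson implication: modus ponens puts
  \<open>(a \<rightharpoonup> b) \<sqinter> a\<close> below \<open>b\<close>, which is disjoint from
  \<open>hneg H b\<close>.\<close>

lemma himp_disjoint_meet_hneg:
  assumes "a \<in> carrier H" "b \<in> carrier H"
  shows "(a \<rightharpoonup> b) \<sqinter> (a \<sqinter> hneg H b) = \<bottom>"
proof -
  have i: "a \<rightharpoonup> b \<in> carrier H" using assms by (simp add: himp_closed)
  then have "lat_le H ((a \<rightharpoonup> b) \<sqinter> a) b" using assms by (simp add: residuation le_refl)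
  then have "((a \<rightharpoonup> b) \<sqinter> a) \<sqinter> hneg H b = \<bottom>"
    using assms i by (metis hneg_antimono hneg_closed le_hneg_iff meet_closed)
  then show ?thesis using assms i by (simp add: meet_assoc hneg_closed)
qed

lemma himp_le_contrapositive:
  assumes "a \<in> carrier H" "b \<in> carrier H"
  shows "lat_le H (a \<rightharpoonup> b) (hneg H b \<rightharpoonup> hneg H a)"
proof -
  have "a \<sqinter> ((a \<rightharpoonup> b) \<sqinter> hneg H b) = \<bottom>"
    using himp_disjoint_meet_hneg[OF assms] assms
    by (metis himp_closed hneg_closed meet_assoc meet_comm)
  then show ?thesis
    using assms by (simp add: himp_closed hneg_closed le_hneg_iff meet_closed flip: residuation)
qed

end

context modal_heyting_algebra
begin

lemma box_dia_hneg:
  assumes "a \<in> carrier M"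
  shows "\<box> a \<sqinter> \<diamond> (hneg M a) = \<bottom>"
  using box_dia[OF assms top_closed] assms by (simp add: top_greatest hneg_closed)

text \<open>The modal axiom at \<open>hneg M a\<close> and \<open>a\<close>: since \<open>a\<close>
  lies below its double negation, the argument of the diamond collapses to \<open>a\<close>.\<close>

lemma dia_box_hneg:
  assumes "a \<in> carrier M"
  shows "\<diamond> a \<sqinter> \<box> (hneg M a) = \<bottom>"
proof -
  have "hneg M (hneg M a) \<sqinter> a = a"
    using le_hneg_hneg[OF assms] assms by (metis hneg_closed lat_le_def meet_comm)
  then show ?thesis
    using box_dia[of "hneg M a" a] assms
    by (metis box_closed dia_closed hneg_closed meet_comm)
qed

lemma twist_simps:
  "(x, y) \<in> carrier (twist M F) \<longleftrightarrow>
    x \<in> carrier M \<and> y \<in> carrier M \<and> x \<sqinter> y = \<bottom> \<and> x \<squnion> y \<in> F"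
  "(x, y) \<squnion>\<^bsub>twist M F\<^esub> (s, t) = (x \<squnion> s, y \<sqinter> t)"
  "(x, y) \<sqinter>\<^bsub>twist M F\<^esub> (s, t) = (x \<sqinter> s, y \<squnion> t)"
  "\<bottom>\<^bsub>twist M F\<^esub> = (\<bottom>, \<top>)"
  "\<top>\<^bsub>twist M F\<^esub> = (\<top>, \<bottom>)"
  "(x, y) \<leadsto>\<^bsub>twist M F\<^esub> (s, t) = ((x \<rightharpoonup> s) \<sqinter> (t \<rightharpoonup> y), x \<sqinter> t)"
  "\<sim>\<^bsub>twist M F\<^esub> (x, y) = (y, x)"
  "nbox (twist M F) (x, y) = (\<box> x, \<diamond> y)"
  "ndia (twist M F) (x, y) = (\<diamond> x, \<box> y)"
  by (simp_all add: twist_def)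

lemma nsq_twist:
  assumes "x \<in> carrier M" "y \<in> carrier M" "x \<sqinter> y = \<bottom>"
  shows "nsq (twist M F) (x, y) = (x, hneg M x)"
  using assms by (simp add: nsq_def twist_def meet_idem himp_closed hneg_closed himp_eq_hneg)

text \<open>Squaring replaces the second coordinate by \<open>hneg M x\<close>, so a pair is
  idempotent exactly when that is already its second coordinate.\<close>

lemma carrier_star_twist:
  assumes "boolean_filter M F"
  shows "carrier (star (twist M F)) = (\<lambda>a. (a, hneg M a)) ` carrier M"
  by (auto simp: star_def twist_simps nsq_twist hneg_closed meet_hneg join_hneg_mem[OF assms])

lemma twist_iso:
  assumes "boolean_filter M F"
  shows "(\<lambda>a. (a, hneg M a)) \<in> modal_heyting_iso M (star (twist M F))"
proof -
  \<comment> \<open>The first coordinate of the Nelson implication also carries the contrapositive,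
    which is implied by \<open>a \<rightharpoonup> b\<close> and so is absorbed.\<close>
  have "(a \<rightharpoonup> b) \<sqinter> (hneg M b \<rightharpoonup> hneg M a) = a \<rightharpoonup> b" if "a \<in> carrier M" "b \<in> carrier M" for a b
    using himp_le_contrapositive[OF that] by (simp add: lat_le_def)
  then show ?thesis
    using carrier_star_twist[OF assms]
    \<comment> \<open>\<open>star\<close> stays folded in the first pass so that the carrier
      equation settles bijectivity; the second pass evaluates the operations, squaring by the
      disjointness lemmas.\<close>
    by (simp add: modal_heyting_iso_def bij_betw_def inj_on_def)
      (simp add: star_def twist_simps nsq_twist join_closed meet_closed himp_closed hneg_closed
        box_closed dia_closed hneg_bot hneg_top meet_hneg join_disjoint_hneg_meet
        meet_disjoint_hneg_join himp_disjoint_meet_hneg box_dia_hneg dia_box_hneg)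
qed

lemma twist_filter_image:
  assumes "boolean_filter M F"
  shows "(\<lambda>a. (a, hneg M a)) ` F = star_filter (twist M F)"
proof -
  have sub: "F \<subseteq> carrier M"
    using assms by (simp add: boolean_filter_def lattice_filter_def)
  \<comment> \<open>The join is \<open>(x \<squnion> y, y \<sqinter> x)\<close>, whose second
    coordinate is \<open>\<bottom>\<close>. As carrier membership says
    \<open>x \<squnion> y \<in> F\<close>, this yields the inclusion of \<open>star_filter\<close>
    in the image of \<open>F\<close>.\<close>
  have val: "nsq (twist M F) ((x, y) \<squnion>\<^bsub>twist M F\<^esub> \<sim>\<^bsub>twist M F\<^esub> (x, y)) = (x \<squnion> y, hneg M (x \<squnion> y))"
    if "x \<in> carrier M" "y \<in> carrier M" "x \<sqinter> y = \<bottom>" for x y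
  proof -
    have "y \<sqinter> x = \<bottom>" using that by (metis meet_comm)
    moreover have "(x \<squnion> y) \<sqinter> \<bottom> = \<bottom>"
      using that by (metis bot_closed bot_least join_closed meet_comm)
    ultimately show ?thesis
      using that by (simp add: twist_simps nsq_twist join_closed bot_closed)
  qed
  have "(a, hneg M a) \<in> star_filter (twist M F)" if "a \<in> F" for a
  proof -
    have a: "a \<in> carrier M" "a \<sqinter> \<bottom> = \<bottom>" "a \<squnion> \<bottom> = a"
      using that sub by (auto simp: join_bot) (metis bot_closed bot_least meet_comm subsetD)
    \<comment> \<open>The witness for the other inclusion: the coordinates of
      \<open>(a, \<bottom>)\<close> join to \<open>a\<close> itself.\<close>
    then have "(a, \<bottom>) \<in> carrier (twist M F)"
      using that by (simp add: twist_simps bot_closed)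
    then show ?thesis
      using val[of a \<bottom>] a by (force simp: star_filter_def bot_closed)
  qed
  then show ?thesis
    by (auto simp: star_filter_def twist_simps(1) val)
qed

end

theorem theorem5:
  fixes M :: "('a, 'm) modal_heyting_alg_scheme" and F :: "'a set"
  assumes "modal_heyting_algebra M"
    and "boolean_filter M F"
    and "\<And>a b. \<lbrakk>a \<in> carrier M; b \<in> carrier M; a \<sqinter>\<^bsub>M\<^esub> b = \<bottom>\<^bsub>M\<^esub>; a \<squnion>\<^bsub>M\<^esub> b \<in> F\<rbrakk>
           \<Longrightarrow> \<box>\<^bsub>M\<^esub> a \<squnion>\<^bsub>M\<^esub> \<diamond>\<^bsub>M\<^esub> b \<in> F"
  shows "(\<lambda>a. (a, hneg M a)) \<in> modal_heyting_iso M (star (twist M F)) \<and>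
         (\<lambda>a. (a, hneg M a)) ` F = star_filter (twist M F)"
  using assms modal_heyting_algebra.twist_iso modal_heyting_algebra.twist_filter_image by blast

end
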